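(* The Petersen graph $P$ is $\mathcal{D}$-unique; that is, if $G$ is a finite simple graph with $D(G,x)=D(P,x)$, then $G$ is isomorphic to $P$.
   Context: All graphs are finite and simple. For a vertex $v$ of a graph $G$, $N[v]$ denotes the closed neighborhood of $v$ ($v$ together with its neighbors), and for $S\subseteq V(G)$, $N[S]=\bigcup_{v\in S}N[v]$. A set $S\subseteq V(G)$ is a dominating set of $G$ if $N[S]=V(G)$. Let $d(G,i)$ be the number of dominating sets of $G$ of cardinality $i$, and let $\gamma(G)$ be the minimum cardinality of a dominating set. The domination polynomial of $G$ is $D(G,x)=\sum_{i=\gamma(G)}^{|V(G)|} d(G,i)x^i$. Two graphs $G,H$ are $\mathcal{D}$-equivalent, written $G\sim H$, if $D(G,x)=D(H,x)$. The equivalence class of $G$ is $[G]=\{H: H\sim G\}$ (graphs considered up to isomorphism), and $G$ is called $\mathcal{D}$-unique if $[G]=\{G\}$. The Petersen graph $P$ is the usual cubic graph on 10 vertices. *)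

theory Defs
  imports
    "Graph_Theory.Digraph_Isomorphism"
    "HOL-Computational_Algebra.Polynomial"
begin

(* A finite simple graph is an instance of the locale graph: a finite, loop-free, symmetric
   digraph without parallel arcs.  An undirected edge is represented by two opposite arcs. *)

definition closed_nbhd :: "('a, 'b) pre_digraph \<Rightarrow> 'a \<Rightarrow> 'a set" where
  "closed_nbhd G v = insert v {u. v \<rightarrow>\<^bsub>G\<^esub> u}"

definition dominating_set :: "('a, 'b) pre_digraph \<Rightarrow> 'a set \<Rightarrow> bool" where
  "dominating_set G S \<longleftrightarrow> S \<subseteq> verts G \<and> (\<Union>v\<in>S. closed_nbhd G v) = verts G"

definition num_dominating_sets :: "('a, 'b) pre_digraph \<Rightarrow> nat \<Rightarrow> nat" where
  "num_dominating_sets G i = card {S. dominating_set G S \<and> card S = i}"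

definition domination_number :: "('a, 'b) pre_digraph \<Rightarrow> nat" where
  "domination_number G = Min (card ` {S. dominating_set G S})"

definition domination_poly :: "('a, 'b) pre_digraph \<Rightarrow> int poly" where
  "domination_poly G =
    (\<Sum>i = domination_number G..card (verts G). monom (int (num_dominating_sets G i)) i)"

(* Outer 5-cycle on 0,...,4; inner pentagram on 5,...,9; spokes joining i to i + 5. *)
definition petersen :: "(nat, nat \<times> nat) pre_digraph" where
  "petersen = \<lparr>
    verts = {0..<10},
    arcs = symcl ((\<lambda>i. (i, (i + 1) mod 5)) ` {0..<5} \<union>
                  (\<lambda>i. (i, i + 5)) ` {0..<5} \<union>
                  (\<lambda>i. (i + 5, (i + 2) mod 5 + 5)) ` {0..<5}),
    tail = fst, head = snd \<rparr>"

lemma graph_petersen: "graph petersen"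
proof
  have proj: "tail petersen = fst" "head petersen = snd"
    by (simp_all add: petersen_def)
  have ends: "arc_to_ends petersen e = e" for e
    by (simp add: arc_to_ends_def proj)
  have ne: "i \<noteq> (i + 1) mod 5" "i \<noteq> (i + 2) mod 5" if "i < 5" for i :: nat
    using that by presburger+
  have sub: "fst e < 10 \<and> snd e < 10 \<and> fst e \<noteq> snd e" if "e \<in> arcs petersen" for e
  proof -
    from that obtain i where "i < 5" and
      "e \<in> {(i, (i + 1) mod 5), (i, i + 5), (i + 5, (i + 2) mod 5 + 5),
        ((i + 1) mod 5, i), (i + 5, i), ((i + 2) mod 5 + 5, i + 5)}"
      unfolding petersen_def symcl_def by force
    moreover from \<open>i < 5\<close> have "(i + 1) mod 5 < 5" "(i + 2) mod 5 < 5"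
      by simp_all
    ultimately show ?thesis
      using ne[of i] by (elim insertE emptyE) (simp_all del: add_2_eq_Suc')
  qed
  show "tail petersen e \<in> verts petersen" "head petersen e \<in> verts petersen"
    "tail petersen e \<noteq> head petersen e" if "e \<in> arcs petersen" for e
    using sub[OF that] by (simp_all add: petersen_def)
  show "finite (verts petersen)" "finite (arcs petersen)"
    by (simp_all add: petersen_def symcl_def)
  show "e1 = e2" if "arc_to_ends petersen e1 = arc_to_ends petersen e2" for e1 e2
    using that by (simp add: ends)
  have "arcs_ends petersen = arcs petersen"
    by (simp add: arcs_ends_def ends)
  moreover have "sym (symcl R)" for R :: "nat rel"
    unfolding symcl_def by (rule symI) auto
  ultimately show "symmetric petersen"
    by (simp add: symmetric_def petersen_def)
qed

end

theory Submission
  imports Defs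
begin

text \<open>
  A set fails to dominate exactly when its complement contains some closed neighbourhood \<open>N[v]\<close>.
  So the domination polynomial of a graph on ten vertices records, for every \<open>k\<close>, the number \<open>e\<^sub>k\<close>
  of \<open>k\<close>-sets of vertices that contain a closed neighbourhood. Four of these numbers determine the
  Petersen graph, for which \<open>e\<^sub>3 = 0\<close>, \<open>e\<^sub>4 = 10\<close>, \<open>e\<^sub>5 = 60\<close> and \<open>e\<^sub>6 = 135\<close>.

  From \<open>e\<^sub>3 = 0\<close> all degrees are at least 3, and \<open>e\<^sub>4 = 10\<close> then says that the graph is cubic with
  distinct closed neighbourhoods. Each of the ten neighbourhoods lies in six 5-sets, so \<open>e\<^sub>5 = 60\<close>
  means that no 5-set contains two of them: two closed neighbourhoods share at most two vertices.
  In particular adjacent vertices have no common neighbour. For 6-sets, a pair of neighbourhoods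
  fits into a common 6-set only if it shares exactly two vertices, and then into exactly one; no 6-set
  contains three neighbourhoods. Each neighbourhood lies in 15 6-sets, so \<open>e\<^sub>6\<close> is 150 minus the
  number of pairs that share two vertices. The 15 edges are such pairs, so \<open>e\<^sub>6 = 135\<close> leaves no
  other pair: non-adjacent vertices have at most one common neighbour. Altogether the graph is cubic
  and without triangles and 4-cycles. Lemma \<open>cubic_girth_5_iff_card_enclosing\<close> states this as an
  equivalence, so that the four numbers for the Petersen graph itself come from its structure.

  In a cubic graph on ten vertices without triangles and 4-cycles, a vertex, its 3 neighbours and
  their 6 further neighbours exhaust the vertices, so any two vertices are at distance at most 2.
  This forces a pentagon whose five spokes end in a pentagram, and the resulting labelling by the
  vertices of the Petersen graph is an isomorphism.
\<close>

section \<open>Counting with small multiplicities\<close>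

lemma sum_multiplicity:
  assumes "finite I" "\<And>i. i \<in> I \<Longrightarrow> finite (A i)"
  shows "(\<Sum>x\<in>(\<Union>i\<in>I. A i). card {i \<in> I. x \<in> A i}) = (\<Sum>i\<in>I. card (A i))"
proof (rule sum_multicount_gen)
  show "\<forall>i\<in>I. card {x \<in> \<Union> (A ` I). x \<in> A i} = card (A i)"
    by (auto intro!: arg_cong[where f = card])
qed (use assms in auto)

text \<open>
  The second moment of the multiplicity counts incidences of a point with ordered pairs of sets: it is
  the first moment for the family of all pairwise intersections, including each set with itself.
\<close>

lemma sum_multiplicity_square:
  assumes "finite I" "\<And>i. i \<in> I \<Longrightarrow> finite (A i)"
  shows "(\<Sum>x\<in>(\<Union>i\<in>I. A i). (card {i \<in> I. x \<in> A i})\<^sup>2) = (\<Sum>i\<in>I. \<Sum>j\<in>I. card (A i \<inter> A j))"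
proof -
  let ?B = "\<lambda>(i, j). A i \<inter> A j"
  have U: "(\<Union>i\<in>I. A i) = (\<Union>p\<in>I \<times> I. ?B p)"
    by auto
  have "card {p \<in> I \<times> I. x \<in> ?B p} = (card {i \<in> I. x \<in> A i})\<^sup>2" for x
  proof -
    have "{p \<in> I \<times> I. x \<in> ?B p} = {i \<in> I. x \<in> A i} \<times> {i \<in> I. x \<in> A i}"
      by auto
    then show ?thesis
      by (simp add: card_cartesian_product power2_eq_square)
  qed
  moreover have "(\<Sum>x\<in>(\<Union>p\<in>I \<times> I. ?B p). card {p \<in> I \<times> I. x \<in> ?B p}) = (\<Sum>p\<in>I \<times> I. card (?B p))"
    by (rule sum_multiplicity) (use assms in auto)
  ultimately show ?thesis
    unfolding U by (simp add: sum.cartesian_product case_prod_unfold)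
qed

text \<open>
  Inclusion-exclusion stops after pairs when no point lies in three sets. On the union the
  multiplicity \<open>m\<close> is 1 or 2, the roots of \<open>m\<^sup>2 - 3 * m + 2\<close>; summing this identity over the union
  expresses its cardinality by the two moments of \<open>m\<close>. The double sum includes the
  diagonal, which raises the factor on the right from 2 to 3.
\<close>

lemma inclusion_exclusion_multiplicity_le_2:
  assumes fin: "finite I" "\<And>i. i \<in> I \<Longrightarrow> finite (A i)"
    and le2: "\<And>x. card {i \<in> I. x \<in> A i} \<le> 2"
  shows "2 * card (\<Union>i\<in>I. A i) + (\<Sum>i\<in>I. \<Sum>j\<in>I. card (A i \<inter> A j)) = 3 * (\<Sum>i\<in>I. card (A i))"
proof -
  let ?U = "\<Union>i\<in>I. A i" and ?m = "\<lambda>x. card {i \<in> I. x \<in> A i}"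
  have "2 + (?m x)\<^sup>2 = 3 * ?m x" if "x \<in> ?U" for x
  proof -
    have "?m x \<noteq> 0"
      using that fin by auto
    with le2[of x] have "?m x = 1 \<or> ?m x = 2"
      by linarith
    then show ?thesis
      by auto
  qed
  then have "(\<Sum>x\<in>?U. 2 + (?m x)\<^sup>2) = (\<Sum>x\<in>?U. 3 * ?m x)"
    by (rule sum.cong[OF refl])
  then have "2 * card ?U + (\<Sum>x\<in>?U. (?m x)\<^sup>2) = 3 * (\<Sum>x\<in>?U. ?m x)"
    unfolding sum.distrib sum_distrib_left[symmetric] by simp
  moreover have "(\<Sum>x\<in>?U. ?m x) = (\<Sum>i\<in>I. card (A i))"
    by (rule sum_multiplicity) (use fin in auto)
  moreover have "(\<Sum>x\<in>?U. (?m x)\<^sup>2) = (\<Sum>i\<in>I. \<Sum>j\<in>I. card (A i \<inter> A j))"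
    by (rule sum_multiplicity_square) (use fin in auto)
  ultimately show ?thesis
    by simp
qed

text \<open>
  The multiplicity is at least 1 on the union, so a point in two sets would make the sum of the
  cardinalities larger than the cardinality of the union.
\<close>

lemma disjoint_if_card_UN_eq_sum:
  assumes fin: "finite I" "\<And>i. i \<in> I \<Longrightarrow> finite (A i)"
    and eq: "card (\<Union>i\<in>I. A i) = (\<Sum>i\<in>I. card (A i))"
    and ij: "i \<in> I" "j \<in> I" "i \<noteq> j"
  shows "A i \<inter> A j = {}"
proof (rule ccontr)
  assume "A i \<inter> A j \<noteq> {}"
  then obtain x where x: "x \<in> A i" "x \<in> A j"
    by blast
  let ?U = "\<Union>i\<in>I. A i" and ?m = "\<lambda>x. card {i \<in> I. x \<in> A i}"
  have "card {i, j} \<le> ?m x"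
    by (rule card_mono) (use fin ij x in auto)
  then have "1 < ?m x"
    using ij by simp
  moreover have "1 \<le> ?m y" if "y \<in> ?U" for y
  proof -
    have "?m y \<noteq> 0"
      using that fin by auto
    then show ?thesis by linarith
  qed
  ultimately have "(\<Sum>y\<in>?U. 1) < (\<Sum>y\<in>?U. ?m y)"
    using x ij fin by (intro sum_strict_mono_ex1) auto
  then show False
    using eq sum_multiplicity[OF fin] by simp
qed

definition supersets :: "'a set \<Rightarrow> nat \<Rightarrow> 'a set \<Rightarrow> 'a set set" where
  "supersets V k A = {T. A \<subseteq> T \<and> T \<subseteq> V \<and> card T = k}"

lemma supersets_Int: "supersets V k A \<inter> supersets V k B = supersets V k (A \<union> B)"
  by (auto simp: supersets_def)

lemma finite_supersets: "finite V \<Longrightarrow> finite (supersets V k A)"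
  by (rule finite_subset[of _ "Pow V"]) (auto simp: supersets_def)

lemma card_supersets:
  assumes "finite V" "A \<subseteq> V" "card A \<le> k"
  shows "card (supersets V k A) = (card V - card A) choose (k - card A)"
proof -
  have finA: "finite A"
    using assms finite_subset by blast
  have "bij_betw (\<lambda>T. T - A) (supersets V k A) {B. B \<subseteq> V - A \<and> card B = k - card A}"
  proof (rule bij_betw_byWitness[where f' = "\<lambda>B. B \<union> A"])
    show "(\<lambda>T. T - A) ` supersets V k A \<subseteq> {B. B \<subseteq> V - A \<and> card B = k - card A}"
      using finA by (auto simp: supersets_def card_Diff_subset)
    have "card (B \<union> A) = k" if "B \<subseteq> V - A" "card B = k - card A" for B
    proof -
      have "finite B"
        using that assms finite_subset by blast
      then have "card (B \<union> A) = card B + card A"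
        using that finA by (intro card_Un_disjoint) auto
      then show ?thesis
        using that assms by simp
    qed
    then show "(\<lambda>B. B \<union> A) ` {B. B \<subseteq> V - A \<and> card B = k - card A} \<subseteq> supersets V k A"
      using assms by (auto simp: supersets_def)
  qed (auto simp: supersets_def)
  then have "card (supersets V k A) = card {B. B \<subseteq> V - A \<and> card B = k - card A}"
    by (rule bij_betw_same_card)
  also have "\<dots> = card (V - A) choose (k - card A)"
    using assms by (intro n_subsets) auto
  finally show ?thesis
    using assms finA by (simp add: card_Diff_subset)
qed

lemma supersets_empty:
  assumes "finite V" "k < card A"
  shows "supersets V k A = {}"
proof -
  have "card A \<le> card T" if "A \<subseteq> T" "T \<subseteq> V" for T
    using that assms(1) by (intro card_mono) (auto intro: finite_subset)
  then show ?thesis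
    using assms(2) unfolding supersets_def by (blast dest: leD)
qed

section \<open>Closed neighbourhoods\<close>

text \<open>
  A finite graph presented by its closed neighbourhoods, that is, by a reflexive symmetric relation.
  Domination depends on closed neighbourhoods only, so arcs matter only when an isomorphism of digraphs is assembled.
\<close>

locale closed_nbhds =
  fixes V :: "'a set" and N :: "'a \<Rightarrow> 'a set"
  assumes finite_V: "finite V"
    and self_in: "v \<in> V \<Longrightarrow> v \<in> N v"
    and N_subset: "v \<in> V \<Longrightarrow> N v \<subseteq> V"
    and N_sym: "v \<in> V \<Longrightarrow> w \<in> N v \<Longrightarrow> v \<in> N w"
begin

lemma finite_N: "v \<in> V \<Longrightarrow> finite (N v)"
  by (rule finite_subset[OF N_subset finite_V])

definition enclosing :: "nat \<Rightarrow> 'a set set" where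
  "enclosing k = (\<Union>v\<in>V. supersets V k (N v))"

text \<open>
  Regularity of degree 3 and girth at least 5, read off closed neighbourhoods: adjacent vertices lie
  in both neighbourhoods themselves, so the value 2 excludes triangles, and the bound 1 for
  non-adjacent vertices excludes 4-cycles.
\<close>

definition cubic_girth_5 :: bool where
  "cubic_girth_5 \<longleftrightarrow> (\<forall>v\<in>V. card (N v) = 4) \<and>
    (\<forall>v\<in>V. \<forall>w\<in>V. v \<noteq> w \<longrightarrow>
      (if w \<in> N v then card (N v \<inter> N w) = 2 else card (N v \<inter> N w) \<le> 1))"

lemma card_nbhd_Un:
  assumes "\<forall>v\<in>V. card (N v) = 4" "v \<in> V" "w \<in> V"
  shows "card (N v \<union> N w) + card (N v \<inter> N w) = 8"
  using card_Un_Int[of "N v" "N w"] assms finite_N by simp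

text \<open>
  If three closed neighbourhoods of size 4 lie in a 6-set, any two of them meet in exactly two points
  and cover it, so that each is the complement of the intersection of the other two. Hence no vertex
  lies in all three, and every vertex of the 6-set lies in at least two. Adjacency between two of the
  centres would place both of them outside the third neighbourhood, while the third centre, lying in a
  second neighbourhood, must be adjacent to one of them. Without adjacencies each centre lies in one
  neighbourhood only, which is also impossible.
\<close>

lemma card_nbhds_inside_6_set:
  assumes c4: "\<forall>v\<in>V. card (N v) = 4"
    and le2: "\<forall>v\<in>V. \<forall>w\<in>V. v \<noteq> w \<longrightarrow> card (N v \<inter> N w) \<le> 2"
    and T: "card T = 6"
  shows "card {v \<in> V. N v \<subseteq> T} \<le> 2"
proof (rule ccontr)
  assume "\<not> ?thesis"
  then have "3 \<le> card {v \<in> V. N v \<subseteq> T}"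
    by linarith
  then obtain S where "S \<subseteq> {v \<in> V. N v \<subseteq> T}" "card S = 3"
    by (rule obtain_subset_with_card_n)
  then obtain u v w where uvw: "u \<in> V" "v \<in> V" "w \<in> V" "N u \<subseteq> T" "N v \<subseteq> T" "N w \<subseteq> T"
      "u \<noteq> v" "u \<noteq> w" "v \<noteq> w"
    by (auto simp: card_3_iff)
  have finT: "finite T"
    using T by (simp add: card_ge_0_finite)
  have two: "N x \<union> N y = T \<and> card (N x \<inter> N y) = 2"
    if "x \<in> V" "y \<in> V" "x \<noteq> y" "N x \<subseteq> T" "N y \<subseteq> T" for x y
  proof -
    have "card (N x \<inter> N y) \<le> 2"
      using le2 that by blast
    moreover have "card (N x \<union> N y) \<le> 6"
      using card_mono[OF finT, of "N x \<union> N y"] that T by simp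
    ultimately have "card (N x \<union> N y) = 6 \<and> card (N x \<inter> N y) = 2"
      using card_nbhd_Un[OF c4 that(1,2)] by linarith
    then show ?thesis
      using card_subset_eq[OF finT, of "N x \<union> N y"] that T by simp
  qed
  have exact: "N z = T - N x \<inter> N y"
    if "x \<in> V" "y \<in> V" "z \<in> V" "x \<noteq> y" "x \<noteq> z" "y \<noteq> z" "N x \<subseteq> T" "N y \<subseteq> T" "N z \<subseteq> T" for x y z
  proof (rule card_subset_eq[symmetric])
    have "card (T - N x \<inter> N y) = 4"
      using two[of x y] that T finite_N[of x] by (subst card_Diff_subset) auto
    then show "card (T - N x \<inter> N y) = card (N z)"
      using c4 that by simp
    show "T - N x \<inter> N y \<subseteq> N z"
      using two[of x z] two[of y z] that by blast
    show "finite (N z)"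
      using that finite_N by blast
  qed
  have no_edge: "y \<notin> N x"
    if "x \<in> V" "y \<in> V" "z \<in> V" "x \<noteq> y" "x \<noteq> z" "y \<noteq> z" "N x \<subseteq> T" "N y \<subseteq> T" "N z \<subseteq> T" for x y z
  proof
    assume "y \<in> N x"
    then have "x \<in> N y"
      using N_sym that by blast
    then have "x \<notin> N z" "y \<notin> N z"
      using exact[OF that] self_in that \<open>y \<in> N x\<close> by blast+
    moreover have "z \<in> N x \<union> N y"
      using two[of x y] self_in[of z] that by blast
    ultimately show False
      using N_sym that by blast
  qed
  have "v \<notin> N u" "w \<notin> N u"
    using no_edge[of u v w] no_edge[of u w v] uvw by blast+
  then have "u \<notin> N v \<union> N w"
    using N_sym uvw by blast
  then show False
    using two[of v w] uvw self_in[of u] by blast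
qed

text \<open>
  Inclusion-exclusion for the families of 6-sets that contain a given neighbourhood: each family has 15
  members, and two of them share one member or none, according to whether the neighbourhoods meet
  in two points. The sum counts ordered pairs, hence the factor 2 and \<open>300 = 3 * 150 - 150\<close>.
\<close>

lemma double_enclosing_6:
  assumes V10: "card V = 10"
    and c4: "\<forall>v\<in>V. card (N v) = 4"
    and le2: "\<forall>v\<in>V. \<forall>w\<in>V. v \<noteq> w \<longrightarrow> card (N v \<inter> N w) \<le> 2"
  shows "2 * card (enclosing 6) + (\<Sum>v\<in>V. card {w \<in> V - {v}. card (N v \<inter> N w) = 2}) = 300"
proof -
  let ?A = "\<lambda>v. supersets V 6 (N v)" and ?P = "\<lambda>v. {w \<in> V - {v}. card (N v \<inter> N w) = 2}"
  have A15: "card (?A v) = 15" if "v \<in> V" for v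
    using that card_supersets[OF finite_V N_subset, of v 6] c4 V10 by (simp add: choose_two)
  have inner: "(\<Sum>w\<in>V. card (?A v \<inter> ?A w)) = 15 + card (?P v)" if v: "v \<in> V" for v
  proof -
    have "card (?A v \<inter> ?A w) = of_bool (card (N v \<inter> N w) = 2)" if w: "w \<in> V - {v}" for w
    proof (cases "card (N v \<inter> N w) = 2")
      case True
      then have "card (N v \<union> N w) = 6"
        using card_nbhd_Un[OF c4, of v w] v w by simp
      then show ?thesis
        using card_supersets[OF finite_V, of "N v \<union> N w" 6] v w N_subset True
        by (simp add: supersets_Int)
    next
      case False
      moreover have "card (N v \<inter> N w) \<le> 2"
        using le2 v w by auto
      ultimately have "card (N v \<inter> N w) < 2"
        by linarith
      then have "6 < card (N v \<union> N w)"
        using card_nbhd_Un[OF c4, of v w] v w by simp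
      then show ?thesis
        using False by (simp add: supersets_Int supersets_empty[OF finite_V])
    qed
    then have "(\<Sum>w\<in>V - {v}. card (?A v \<inter> ?A w)) = (\<Sum>w\<in>V - {v}. of_bool (card (N v \<inter> N w) = 2))"
      by (rule sum.cong[OF refl])
    also have "\<dots> = card (?P v)"
      using finite_V by (simp add: sum_of_bool_eq Int_def)
    finally show ?thesis
      using v finite_V A15[OF v] by (simp add: sum.remove[of V v])
  qed
  have "2 * card (\<Union>v\<in>V. ?A v) + (\<Sum>v\<in>V. \<Sum>w\<in>V. card (?A v \<inter> ?A w)) = 3 * (\<Sum>v\<in>V. card (?A v))"
  proof (rule inclusion_exclusion_multiplicity_le_2)
    fix T
    show "card {v \<in> V. T \<in> ?A v} \<le> 2"
    proof (cases "T \<subseteq> V \<and> card T = 6")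
      case True
      then show ?thesis
        using card_nbhds_inside_6_set[OF c4 le2, of T] by (simp add: supersets_def)
    next
      case False
      then have none: "{v \<in> V. T \<in> ?A v} = {}"
        by (auto simp: supersets_def)
      show ?thesis
        unfolding none by simp
    qed
  qed (use finite_V finite_supersets in auto)
  then show ?thesis
    by (simp add: inner A15 sum.distrib V10 enclosing_def)
qed

lemma cubic_girth_5_pairD:
  assumes "cubic_girth_5" "v \<in> V" "w \<in> V" "v \<noteq> w"
  shows "if w \<in> N v then card (N v \<inter> N w) = 2 else card (N v \<inter> N w) \<le> 1"
  using assms unfolding cubic_girth_5_def by blast

lemma cubic_girth_5_adjacentD:
  assumes "cubic_girth_5" "v \<in> V" "w \<in> N v" "w \<noteq> v"
  shows "N v \<inter> N w = {v, w}"
proof (rule card_subset_eq[symmetric])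
  have w: "w \<in> V"
    using assms N_subset by blast
  show "{v, w} \<subseteq> N v \<inter> N w"
    using assms w self_in N_sym by blast
  show "card {v, w} = card (N v \<inter> N w)"
    using assms w by (auto simp: cubic_girth_5_def)
  show "finite (N v \<inter> N w)"
    using assms finite_N by blast
qed

lemma unique_common_pair:
  assumes "cubic_girth_5" "v \<in> V" "w \<in> V" "v \<noteq> w" "x \<in> N v \<inter> N w" "y \<in> N v \<inter> N w" "x \<noteq> y"
  shows "{x, y} = {v, w}"
proof (cases "w \<in> N v")
  case True
  then have "N v \<inter> N w = {v, w}"
    using cubic_girth_5_adjacentD[OF assms(1,2)] assms(4) by simp
  then show ?thesis
    using assms(5-7) by (auto simp: doubleton_eq_iff)
next
  case False
  have "card {x, y} \<le> card (N v \<inter> N w)"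
    by (rule card_mono) (use assms finite_N in auto)
  moreover have "card (N v \<inter> N w) \<le> 1"
    using cubic_girth_5_pairD[OF assms(1-4)] False by simp
  ultimately show ?thesis
    using assms by simp
qed

text \<open>
  Absence of triangles and of 4-cycles as a single rule, in which \<open>y\<close> may be one of \<open>v\<close> and \<open>w\<close>.
  If it is, then \<open>v\<close> and \<open>w\<close> are adjacent and the rule excludes the triangle \<open>v, w, x\<close>; if not, it
  excludes the 4-cycle \<open>v, x, w, y\<close>.
\<close>

lemma no_second_common:
  assumes "cubic_girth_5" "v \<in> V" "w \<in> V" "v \<noteq> w" "x \<in> N v" "x \<in> N w" "y \<in> N v" "y \<in> N w"
    and "x \<noteq> v" "x \<noteq> w"
  shows "x = y"
  using unique_common_pair[OF assms(1-4), of x y] assms by (auto simp: doubleton_eq_iff)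

text \<open>
  In the converse direction the counts are used one after the other, in
  increasing size, since each of them is informative only once the smaller ones are understood.
\<close>

theorem cubic_girth_5_iff_card_enclosing:
  assumes V10: "card V = 10"
  shows "cubic_girth_5 \<longleftrightarrow> card (enclosing 3) = 0 \<and> card (enclosing 4) = 10 \<and>
    card (enclosing 5) = 60 \<and> card (enclosing 6) = 135"
proof (intro iffI conjI)
  assume G: "cubic_girth_5"
  then have c4: "\<forall>v\<in>V. card (N v) = 4"
    by (simp add: cubic_girth_5_def)
  have le2: "\<forall>v\<in>V. \<forall>w\<in>V. v \<noteq> w \<longrightarrow> card (N v \<inter> N w) \<le> 2"
  proof (intro ballI impI)
    fix v w assume "v \<in> V" "w \<in> V" "v \<noteq> w"
    then show "card (N v \<inter> N w) \<le> 2"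
      using cubic_girth_5_pairD[OF G, of v w] by (simp split: if_splits)
  qed
  show "card (enclosing 3) = 0"
    using c4 by (simp add: enclosing_def supersets_empty[OF finite_V])
  have disj: "supersets V k (N v) \<inter> supersets V k (N w) = {}"
    if "k < 6" "v \<in> V" "w \<in> V" "v \<noteq> w" for k v w
  proof -
    have "card (N v \<inter> N w) \<le> 2"
      using le2 that by blast
    then have "k < card (N v \<union> N w)"
      using card_nbhd_Un[OF c4 that(2,3)] that(1) by linarith
    then show ?thesis
      by (simp add: supersets_Int supersets_empty[OF finite_V])
  qed
  have sum: "card (enclosing k) = (\<Sum>v\<in>V. card (supersets V k (N v)))" if "k < 6" for k
    unfolding enclosing_def
    by (rule card_UN_disjoint) (use finite_V finite_supersets disj that in auto)
  have each: "card (supersets V k (N v)) = 6 choose (k - 4)" if "v \<in> V" "4 \<le> k" for k v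
    using card_supersets[OF finite_V N_subset, of v k] c4 V10 that by simp
  show "card (enclosing 4) = 10" "card (enclosing 5) = 60"
    using V10 by (simp_all add: sum each)
  have "card {w \<in> V - {v}. card (N v \<inter> N w) = 2} = 3" if v: "v \<in> V" for v
  proof -
    have "w \<in> N v \<longleftrightarrow> card (N v \<inter> N w) = 2" if "w \<in> V - {v}" for w
      using cubic_girth_5_pairD[OF G v, of w] that by (auto split: if_splits)
    then have "{w \<in> V - {v}. card (N v \<inter> N w) = 2} = N v - {v}"
      using N_subset[OF v] by blast
    then show ?thesis
      using c4 v self_in finite_N by simp
  qed
  then show "card (enclosing 6) = 135"
    using double_enclosing_6[OF V10 c4 le2] V10 by simp
next
  assume *: "card (enclosing 3) = 0 \<and> card (enclosing 4) = 10 \<and>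
    card (enclosing 5) = 60 \<and> card (enclosing 6) = 135"
  have fin_enc: "finite (enclosing k)" for k
    using finite_V finite_supersets by (auto simp: enclosing_def)
  have ge4: "4 \<le> card (N v)" if v: "v \<in> V" for v
  proof (rule ccontr)
    assume "\<not> 4 \<le> card (N v)"
    then have "0 < card (supersets V 3 (N v))"
      using card_supersets[OF finite_V N_subset[OF v], of 3] card_mono[OF finite_V N_subset[OF v]] V10
      by (simp add: zero_less_binomial_iff)
    moreover have "supersets V 3 (N v) \<subseteq> enclosing 3"
      using v by (auto simp: enclosing_def)
    ultimately show False
      using * card_mono[OF fin_enc] by (metis less_le_not_le)
  qed
  \<comment> \<open>Since no neighbourhood has fewer than 4 elements, a 4-set that contains one is equal to it.\<close>
  have enc4: "enclosing 4 = N ` {v \<in> V. card (N v) = 4}"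
  proof (intro equalityI subsetI)
    fix T assume "T \<in> enclosing 4"
    then obtain v where v: "v \<in> V" "N v \<subseteq> T" "T \<subseteq> V" "card T = 4"
      by (auto simp: enclosing_def supersets_def)
    then have "finite T"
      using finite_V finite_subset by blast
    then have "N v = T"
      using v ge4[of v] card_mono[of T "N v"] by (intro card_subset_eq) auto
    then show "T \<in> N ` {v \<in> V. card (N v) = 4}"
      using v by auto
  qed (use N_subset in \<open>auto simp: enclosing_def supersets_def\<close>)
  \<comment> \<open>Only vertices of degree 3 contribute to the ten sets, so every vertex has degree 3.\<close>
  let ?W = "{v \<in> V. card (N v) = 4}"
  have finW: "finite ?W"
    using finite_V by simp
  have "10 \<le> card ?W" "card ?W \<le> 10"
    using card_image_le[OF finW, of N] * enc4 card_mono[OF finite_V, of ?W] V10 by auto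
  then have "?W = V"
    using V10 by (intro card_subset_eq[OF finite_V]) auto
  then have c4: "\<forall>v\<in>V. card (N v) = 4"
    by blast
  have inj: "inj_on N V"
    using * enc4 V10 \<open>?W = V\<close> finite_V by (intro eq_card_imp_inj_on) auto
  have "card (supersets V 5 (N v)) = 6" if "v \<in> V" for v
    using card_supersets[OF finite_V N_subset, of v 5] c4 V10 that by simp
  \<comment> \<open>Ten families of six 5-sets with a union of size 60 are pairwise disjoint.\<close>
  then have "card (\<Union>v\<in>V. supersets V 5 (N v)) = (\<Sum>v\<in>V. card (supersets V 5 (N v)))"
    using * V10 by (simp add: enclosing_def)
  then have disj5: "supersets V 5 (N v) \<inter> supersets V 5 (N w) = {}"
    if "v \<in> V" "w \<in> V" "v \<noteq> w" for v w
    using disjoint_if_card_UN_eq_sum[of V "\<lambda>v. supersets V 5 (N v)"] that finite_V finite_supersets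
    by blast
  have le2: "\<forall>v\<in>V. \<forall>w\<in>V. v \<noteq> w \<longrightarrow> card (N v \<inter> N w) \<le> 2"
  proof (intro ballI impI, rule ccontr)
    fix v w assume vw: "v \<in> V" "w \<in> V" "v \<noteq> w" and "\<not> card (N v \<inter> N w) \<le> 2"
    then have "card (N v \<union> N w) \<le> 5"
      using card_nbhd_Un[OF c4 vw(1,2)] by linarith
    moreover have "N v \<union> N w \<subseteq> V"
      using vw N_subset by blast
    ultimately have "0 < card (supersets V 5 (N v \<union> N w))"
      using card_supersets[OF finite_V, of "N v \<union> N w" 5] V10 
      by (simp add: zero_less_binomial_iff)
    then show False
      using disj5[OF vw] by (simp add: supersets_Int)
  qed
  \<comment> \<open>Every neighbour is a partner in a pair that shares two points; the count of 6-sets allows 30 ordered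
    pairs in total, which the 30 ordered adjacent pairs already use up.\<close>
  let ?P = "\<lambda>v. {w \<in> V - {v}. card (N v \<inter> N w) = 2}"
  have sub: "N v - {v} \<subseteq> ?P v" if v: "v \<in> V" for v
  proof
    fix w assume w: "w \<in> N v - {v}"
    then have wV: "w \<in> V"
      using N_subset v by blast
    have "{v, w} \<subseteq> N v \<inter> N w"
      using self_in[OF v] self_in[OF wV] N_sym[OF v, of w] w by blast
    then have "card {v, w} \<le> card (N v \<inter> N w)"
      by (rule card_mono[rotated]) (use finite_N[OF v] in simp)
    moreover have "card (N v \<inter> N w) \<le> 2"
      using le2[rule_format, OF v wV] w by auto
    ultimately show "w \<in> ?P v"
      using w wV by auto
  qed
  have c3: "card (N v - {v}) = 3" if "v \<in> V" for v
    using c4 that self_in finite_N by simp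
  have ge3: "3 \<le> card (?P v)" if "v \<in> V" for v
    using card_mono[OF _ sub[OF that]] c3[OF that] finite_V by simp
  have "(\<Sum>v\<in>V. card (?P v)) = (\<Sum>v\<in>V. 3)"
    using double_enclosing_6[OF V10 c4 le2] * V10 by simp
  then have "card (?P v) = 3" if "v \<in> V" for v
    using sum_mono_inv[of "\<lambda>_. 3" V "\<lambda>v. card (?P v)" v] ge3 finite_V that by simp
  then have P_eq: "N v - {v} = ?P v" if "v \<in> V" for v
    using sub[OF that] c3[OF that] finite_V that by (intro card_subset_eq) auto
  have "if w \<in> N v then card (N v \<inter> N w) = 2 else card (N v \<inter> N w) \<le> 1"
    if vw: "v \<in> V" "w \<in> V" "v \<noteq> w" for v w
  proof -
    have "w \<in> N v \<longleftrightarrow> card (N v \<inter> N w) = 2"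
      using P_eq[OF vw(1)] vw by blast
    moreover have "card (N v \<inter> N w) \<le> 2"
      using le2 vw by blast
    ultimately show ?thesis
      by auto
  qed
  then show "cubic_girth_5"
    using c4 unfolding cubic_girth_5_def by blast
qed

section \<open>Cubic graphs of girth five on ten vertices\<close>

text \<open>
  The Moore bound is attained: the neighbourhoods of the three neighbours of \<open>v\<close> meet only in \<open>v\<close>, so they
  cover \<open>1 + 3 * 3 = 10\<close> vertices, which is everything.
\<close>

lemma common_nbhd_element:
  assumes G: "cubic_girth_5" and V10: "card V = 10" and vw: "v \<in> V" "w \<in> V"
  shows "\<exists>u\<in>V. v \<in> N u \<and> w \<in> N u"
proof (cases "w \<in> N v")
  case True
  then show ?thesis
    using vw self_in by blast
next
  case False
  let ?A = "\<lambda>u. N u - {v}"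
  have c4: "card (N x) = 4" if "x \<in> V" for x
    using G that by (simp add: cubic_girth_5_def)
  have nb: "u \<in> V" "v \<in> N u" if "u \<in> N v" for u
    using that vw N_subset N_sym by blast+
  have disj: "?A u \<inter> ?A u' = {}" if "u \<in> N v - {v}" "u' \<in> N v - {v}" "u \<noteq> u'" for u u'
  proof (rule ccontr)
    assume "?A u \<inter> ?A u' \<noteq> {}"
    then obtain x where "x \<in> N u \<inter> N u'" "x \<noteq> v"
      by blast
    then have "{x, v} = {u, u'}"
      using unique_common_pair[OF G, of u u' x v] that nb by blast
    then show False
      using that by (auto simp: doubleton_eq_iff)
  qed
  have "card (\<Union>u\<in>N v - {v}. ?A u) = (\<Sum>u\<in>N v - {v}. card (?A u))"
    by (rule card_UN_disjoint) (use disj vw nb finite_N in auto)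
  also have "\<dots> = (\<Sum>u\<in>N v - {v}. 3)"
    by (rule sum.cong) (use nb finite_N c4 in auto)
  also have "\<dots> = 9"
    using c4 vw self_in finite_N by simp
  finally have "card (\<Union>u\<in>N v - {v}. ?A u) = card (V - {v})"
    using V10 vw finite_V by simp
  then have "(\<Union>u\<in>N v - {v}. ?A u) = V - {v}"
    using nb N_subset finite_V by (intro card_subset_eq) auto
  moreover have "w \<in> V - {v}"
    using vw False self_in[OF vw(1)] by auto
  ultimately have "w \<in> (\<Union>u\<in>N v - {v}. ?A u)"
    by simp
  then show ?thesis
    using nb by blast
qed

text \<open>
  Let \<open>s\<^sub>i\<close> be the neighbour of \<open>c\<^sub>i\<close> outside the pentagon. The vertex \<open>s\<^sub>0\<close> and the opposite
  pentagon vertex \<open>c\<^sub>2\<close> are at distance at most 2, but the two pentagon neighbours of \<open>c\<^sub>2\<close> cannot be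
  adjacent to \<open>s\<^sub>0\<close> without a triangle or a 4-cycle. So the connection runs through \<open>s\<^sub>2\<close>;
  symmetrically for \<open>s\<^sub>3\<close>.

  The hypotheses are invariant under rotating the pentagon, which gives the neighbourhoods of the
  other spoke ends.
\<close>

lemma nbhd_of_spoke:
  assumes G: "cubic_girth_5" and V10: "card V = 10"
    and V: "c0 \<in> V" "c1 \<in> V" "c2 \<in> V" "c3 \<in> V" "c4 \<in> V"
    and N0: "N c0 = {c0, c1, c4, s0}" and N1: "N c1 = {c1, c2, c0, s1}"
    and N2: "N c2 = {c2, c3, c1, s2}" and N3: "N c3 = {c3, c4, c2, s3}"
    and N4: "N c4 = {c4, c0, c3, s4}"
  shows "N s0 = {s0, c0, s2, s3}"
proof -
  have card4: "card (N x) = 4" if "x \<in> V" for x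
    using G that by (simp add: cubic_girth_5_def)
  have dist: "distinct [a, b, c, d]" if "card {a, b, c, d} = 4" for a b c d :: 'a
    using that by (intro card_distinct) simp
  have d: "distinct [c0, c1, c4, s0]" "distinct [c1, c2, c0, s1]" "distinct [c2, c3, c1, s2]"
      "distinct [c3, c4, c2, s3]" "distinct [c4, c0, c3, s4]"
    using card4[OF V(1)] card4[OF V(2)] card4[OF V(3)] card4[OF V(4)] card4[OF V(5)]
    unfolding N0 N1 N2 N3 N4 by (blast intro: dist)+
  have s: "s0 \<in> V" "s2 \<in> V" "s3 \<in> V"
    using N_subset[OF V(1)] N_subset[OF V(3)] N_subset[OF V(4)] N0 N2 N3 by blast+
  have n14: "s0 \<notin> N c1" "s0 \<notin> N c4"
    using no_second_common[OF G V(1,2), of s0 c0] no_second_common[OF G V(1,5), of s0 c0] d N0 N1 N4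
    by auto
  then have ne: "s0 \<noteq> c2" "s0 \<noteq> c3"
    using N1 N4 by auto
  then have n23: "s0 \<notin> N c2" "s0 \<notin> N c3"
    using no_second_common[OF G V(1,3), of s0 c1] no_second_common[OF G V(1,4), of s0 c4] d N0 N1 N2 N3 N4
    by auto
  then have ne': "s0 \<noteq> s2" "s0 \<noteq> s3"
    using N2 N3 by auto
  have "s2 \<noteq> s3"
    using no_second_common[OF G V(3,4), of s2 c2] d N2 N3 by auto
  moreover have "c0 \<noteq> s2" "c0 \<noteq> s3"
    using no_second_common[OF G V(2,3), of c0 c1] no_second_common[OF G V(5,4), of c0 c4] d N1 N2 N3 N4
    by auto
  moreover note ne'
  ultimately have card_nbrs: "card {s0, c0, s2, s3} = 4"
    using d by auto
  have "s2 \<in> N s0"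
  proof -
    obtain u where u: "u \<in> V" "s0 \<in> N u" "c2 \<in> N u"
      using common_nbhd_element[OF G V10 s(1) V(3)] by blast
    then have "u \<in> N c2"
      using N_sym by blast
    then have "u = s2"
      using u n14 n23 N2 by auto
    then show ?thesis
      using u N_sym by blast
  qed
  moreover have "s3 \<in> N s0"
  proof -
    obtain u where u: "u \<in> V" "s0 \<in> N u" "c3 \<in> N u"
      using common_nbhd_element[OF G V10 s(1) V(4)] by blast
    then have "u \<in> N c3"
      using N_sym by blast
    then have "u = s3"
      using u n14 n23 N3 by auto
    then show ?thesis
      using u N_sym by blast
  qed
  moreover have "c0 \<in> N s0" "s0 \<in> N s0"
    using N_sym[OF V(1)] N0 self_in s by auto
  ultimately have "{s0, c0, s2, s3} = N s0"
    using card4 s finite_N card_nbrs by (intro card_subset_eq) auto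
  then show ?thesis by simp
qed

text \<open>
  Start from a path \<open>c\<^sub>4, c\<^sub>0, c\<^sub>1, c\<^sub>2\<close>; its ends are not adjacent, so a common neighbour \<open>c\<^sub>3\<close> closes
  it to a pentagon.
\<close>

lemma pentagon_with_spokes:
  assumes G: "cubic_girth_5" and V10: "card V = 10"
  obtains c0 c1 c2 c3 c4 s0 s1 s2 s3 s4
  where "c0 \<in> V" "c1 \<in> V" "c2 \<in> V" "c3 \<in> V" "c4 \<in> V"
    and "N c0 = {c0, c1, c4, s0}" "N c1 = {c1, c2, c0, s1}" "N c2 = {c2, c3, c1, s2}"
      "N c3 = {c3, c4, c2, s3}" "N c4 = {c4, c0, c3, s4}"
proof -
  have card4: "card (N x) = 4" if "x \<in> V" for x
    using G that by (simp add: cubic_girth_5_def)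
  have last: "\<exists>z. N v = {v, x, y, z}"
    if "v \<in> V" "x \<in> N v" "y \<in> N v" "v \<noteq> x" "v \<noteq> y" "x \<noteq> y" for v x y
  proof -
    have sub: "{v, x, y} \<subseteq> N v"
      using that self_in by simp
    then have "card (N v - {v, x, y}) = 1"
      using that card4 by (subst card_Diff_subset) auto
    then obtain z where "N v - {v, x, y} = {z}"
      by (rule card_1_singletonE)
    then show ?thesis
      using sub by blast
  qed
  obtain c0 where c0: "c0 \<in> V"
    using V10 by fastforce
  have "card (N c0 - {c0}) = 3"
    using card4[OF c0] self_in[OF c0] finite_N[OF c0] by simp
  then obtain c1 c4 s0 where N0': "N c0 - {c0} = {c1, c4, s0}" and d0: "c1 \<noteq> c4" "c1 \<noteq> s0" "c4 \<noteq> s0"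
    by (auto simp: card_3_iff)
  then have N0: "N c0 = {c0, c1, c4, s0}" and d0': "c0 \<noteq> c1" "c0 \<noteq> c4"
    using self_in[OF c0] by blast+
  have c1: "c1 \<in> V" and c4: "c4 \<in> V"
    using N_subset[OF c0] N0 by auto
  have "c0 \<in> N c1" and c04: "c0 \<in> N c4"
    using N_sym[OF c0] N0 by auto
  then have "card (N c1 - {c1, c0}) = 2"
    using card4[OF c1] self_in[OF c1] d0' by (subst card_Diff_subset) auto
  then obtain c2 s1 where N1': "N c1 - {c1, c0} = {c2, s1}"
    by (auto simp: card_2_iff)
  then have N1: "N c1 = {c1, c2, c0, s1}" and d1: "c2 \<noteq> c1" "c2 \<noteq> c0"
    using self_in[OF c1] \<open>c0 \<in> N c1\<close> by blast+
  have c2: "c2 \<in> V"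
    using N_subset[OF c1] N1 by auto
  have c12: "c1 \<in> N c2"
    using N_sym[OF c1] N1 by auto
  have "c4 \<notin> N c1"
    using no_second_common[OF G c0 c1, of c4 c0] N0 N1 d0 d0' by auto
  then have "c2 \<noteq> c4"
    using N1 by auto
  have "c2 \<notin> N c0"
    using no_second_common[OF G c0 c1, of c2 c0] N0 N1 d0' d1 by auto
  have "c4 \<notin> N c2"
    using no_second_common[OF G c0 c2, of c4 c1] N0 c12 d0 d0' d1 \<open>c2 \<noteq> c4\<close> by auto
  then have "c2 \<notin> N c4"
    using N_sym[OF c4] by blast
  obtain c3 where c3: "c3 \<in> V" "c2 \<in> N c3" "c4 \<in> N c3"
    using common_nbhd_element[OF G V10 c2 c4] by blast
  have d3: "c3 \<noteq> c0" "c3 \<noteq> c1" "c3 \<noteq> c2" "c3 \<noteq> c4"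
    using c3 \<open>c4 \<notin> N c1\<close> \<open>c2 \<notin> N c0\<close> \<open>c4 \<notin> N c2\<close> \<open>c2 \<notin> N c4\<close> by auto
  have c3': "c3 \<in> N c2" "c3 \<in> N c4"
    using N_sym[OF c3(1)] c3 by auto
  obtain s2 where N2: "N c2 = {c2, c3, c1, s2}"
    using last[OF c2, of c3 c1] c3' c12 d1 d3 by auto
  obtain s3 where N3: "N c3 = {c3, c4, c2, s3}"
    using last[OF c3(1), of c4 c2] c3 d3 \<open>c2 \<noteq> c4\<close> by auto
  obtain s4 where N4: "N c4 = {c4, c0, c3, s4}"
    using last[OF c4, of c0 c3] c04 c3' d0' d3 by auto
  show thesis
    by (rule that[OF c0 c1 c2 c3(1) c4 N0 N1 N2 N3 N4])
qed

end

text \<open>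
  A map that sends neighbourhoods onto neighbourhoods of the same size is injective on each of them.
  This is enough for injectivity because any two vertices lie in a common closed neighbourhood.
\<close>

lemma bij_betw_if_preserves_nbhds:
  assumes V: "closed_nbhds V N" "closed_nbhds.cubic_girth_5 V N" "card V = 10"
    and W: "closed_nbhds W M" "closed_nbhds.cubic_girth_5 W M" "card W = 10"
    and f: "f ` V \<subseteq> W" "\<And>v. v \<in> V \<Longrightarrow> f ` N v = M (f v)"
  shows "bij_betw f V W"
proof -
  interpret V: closed_nbhds V N by fact
  interpret W: closed_nbhds W M by fact
  have "v = v'" if v: "v \<in> V" "v' \<in> V" "f v = f v'" for v v'
  proof -
    obtain u where u: "u \<in> V" "v \<in> N u" "v' \<in> N u"
      using V.common_nbhd_element[OF V(2,3) v(1,2)] by blast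
    have "card (f ` N u) = card (N u)"
      using V(2) W(2) f u by (auto simp: V.cubic_girth_5_def W.cubic_girth_5_def)
    then have "inj_on f (N u)"
      using V.finite_N[OF u(1)] by (intro eq_card_imp_inj_on)
    then show ?thesis
      using u v by (blast dest: inj_onD)
  qed
  then have inj: "inj_on f V"
    by (intro inj_onI)
  then have "f ` V = W"
    using f(1) V(3) W(3) W.finite_V by (intro card_subset_eq) (auto simp: card_image)
  then show ?thesis
    using inj by (simp add: bij_betw_def)
qed

lemma (in graph) closed_nbhds_graph: "closed_nbhds (verts G) (closed_nbhd G)"
proof
  show "v \<in> closed_nbhd G w" if "v \<in> verts G" "w \<in> closed_nbhd G v" for v w
    using that arcs_ends_symmetric[OF sym_arcs] by (auto simp: closed_nbhd_def)
qed (auto simp: closed_nbhd_def intro: adj_in_verts)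

section \<open>The Petersen graph\<close>

lemma less_10_eq: "{0..<10} = {0, 1, 2, 3, 4, 5, 6, 7, 8, 9 :: nat}"
  by auto

lemma less_5_eq: "{0..<5} = {0, 1, 2, 3, 4 :: nat}"
  by auto

lemma verts_petersen: "verts petersen = {0..<10}"
  by (simp add: petersen_def)

lemma arcs_ends_petersen: "arcs_ends petersen =
  symcl {(0, 1), (1, 2), (2, 3), (3, 4), (4, 0), (0, 5), (1, 6), (2, 7), (3, 8), (4, 9),
    (5, 7), (6, 8), (7, 9), (8, 5), (9, 6)}"
  by (simp add: petersen_def arcs_ends_conv less_5_eq insert_commute numeral_2_eq_2)

lemma closed_nbhd_petersen:
  "closed_nbhd petersen 0 = {0, 1, 4, 5}" "closed_nbhd petersen 1 = {1, 2, 0, 6}"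
  "closed_nbhd petersen 2 = {2, 3, 1, 7}" "closed_nbhd petersen 3 = {3, 4, 2, 8}"
  "closed_nbhd petersen 4 = {4, 0, 3, 9}" "closed_nbhd petersen 5 = {5, 0, 7, 8}"
  "closed_nbhd petersen 6 = {6, 1, 8, 9}" "closed_nbhd petersen 7 = {7, 2, 9, 5}"
  "closed_nbhd petersen 8 = {8, 3, 5, 6}" "closed_nbhd petersen 9 = {9, 4, 6, 7}"
  by (auto simp: closed_nbhd_def arcs_ends_petersen symcl_def)

interpretation petersen: closed_nbhds "{0..<10}" "closed_nbhd petersen"
  using graph.closed_nbhds_graph[OF graph_petersen] by (simp add: verts_petersen)

lemma cubic_girth_5_petersen: "petersen.cubic_girth_5"
  unfolding petersen.cubic_girth_5_def unfolding less_10_eq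
  \<comment> \<open>The simplifier rewrites \<open>1\<close> to \<open>Suc 0\<close>, hence the second form of that equation.\<close>
  by (simp add: closed_nbhd_petersen closed_nbhd_petersen(2)[unfolded One_nat_def])

lemma (in closed_nbhds) petersen_labelling:
  assumes G: "cubic_girth_5" and V10: "card V = 10"
  obtains f where "bij_betw f {0..<10} V"
    and "\<And>i. i \<in> {0..<10} \<Longrightarrow> f ` closed_nbhd petersen i = N (f i)"
proof -
  obtain c0 c1 c2 c3 c4 s0 s1 s2 s3 s4
    where c: "c0 \<in> V" "c1 \<in> V" "c2 \<in> V" "c3 \<in> V" "c4 \<in> V"
      and Nc: "N c0 = {c0, c1, c4, s0}" "N c1 = {c1, c2, c0, s1}" "N c2 = {c2, c3, c1, s2}"
        "N c3 = {c3, c4, c2, s3}" "N c4 = {c4, c0, c3, s4}"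
    by (rule pentagon_with_spokes[OF G V10])
  note spoke = nbhd_of_spoke[OF G V10]
  have Ns: "N s0 = {s0, c0, s2, s3}" "N s1 = {s1, c1, s3, s4}" "N s2 = {s2, c2, s4, s0}"
      "N s3 = {s3, c3, s0, s1}" "N s4 = {s4, c4, s1, s2}"
    using spoke[OF c Nc] spoke[OF c(2,3,4,5,1) Nc(2,3,4,5,1)] spoke[OF c(3,4,5,1,2) Nc(3,4,5,1,2)]
      spoke[OF c(4,5,1,2,3) Nc(4,5,1,2,3)] spoke[OF c(5,1,2,3,4) Nc(5,1,2,3,4)] by simp_all
  have s: "s0 \<in> V" "s1 \<in> V" "s2 \<in> V" "s3 \<in> V" "s4 \<in> V"
    using c[THEN N_subset] unfolding Nc by simp_all
  let ?f = "\<lambda>i. [c0, c1, c2, c3, c4, s0, s1, s2, s3, s4] ! i"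
  have img: "?f ` closed_nbhd petersen i = N (?f i)" if "i \<in> {0..<10}" for i
    using that Nc Ns unfolding less_10_eq
    by (elim insertE emptyE) (simp_all add: closed_nbhd_petersen closed_nbhd_petersen(2)[unfolded One_nat_def])
  moreover have "?f ` {0..<10} \<subseteq> V"
    using c s by (simp add: less_10_eq)
  ultimately have "bij_betw ?f {0..<10} V"
    using cubic_girth_5_petersen G V10
    by (intro bij_betw_if_preserves_nbhds[where N = "closed_nbhd petersen" and M = N])
      (simp_all add: petersen.closed_nbhds_axioms closed_nbhds_axioms)
  then show thesis
    using img that by blast
qed

section \<open>Isomorphism from closed neighbourhoods\<close>

lemma graph_adj_iff_closed_nbhd:
  assumes "graph G"
  shows "u \<rightarrow>\<^bsub>G\<^esub> v \<longleftrightarrow> v \<in> closed_nbhd G u \<and> v \<noteq> u"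
proof -
  interpret graph G by fact
  show ?thesis
    using adj_not_same by (auto simp: closed_nbhd_def)
qed

text \<open>
  Without parallel arcs, arcs correspond to adjacent pairs of vertices, so the map on arcs is
  determined by the map on vertices.
\<close>

lemma digraph_iso_if_bij_preserves_closed_nbhd:
  assumes G: "graph G" and H: "graph H"
    and bij: "bij_betw g (verts G) (verts H)"
    and nbhd: "\<And>v. v \<in> verts G \<Longrightarrow> g ` closed_nbhd G v = closed_nbhd H (g v)"
  shows "digraph_iso G H"
proof -
  interpret G: graph G by fact
  interpret H: graph H by fact
  have inj: "g u = g v \<longleftrightarrow> u = v" if "u \<in> verts G" "v \<in> verts G" for u v
    using bij that by (auto simp: bij_betw_def dest: inj_onD)
  have adj: "g u \<rightarrow>\<^bsub>H\<^esub> g v \<longleftrightarrow> u \<rightarrow>\<^bsub>G\<^esub> v" if uv: "u \<in> verts G" "v \<in> verts G" for u v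
  proof -
    have "closed_nbhd G u \<subseteq> verts G"
      using closed_nbhds.N_subset[OF G.closed_nbhds_graph] uv by blast
    then have "g v \<in> g ` closed_nbhd G u \<longleftrightarrow> v \<in> closed_nbhd G u"
      using inj uv by blast
    then show ?thesis
      using uv by (simp add: graph_adj_iff_closed_nbhd[OF G] graph_adj_iff_closed_nbhd[OF H] nbhd inj)
  qed
  have ends: "bij_betw (map_prod g g) (arcs_ends G) (arcs_ends H)"
    unfolding bij_betw_def
  proof (intro conjI equalityI subsetI)
    show "inj_on (map_prod g g) (arcs_ends G)"
    proof (rule inj_on_subset)
      show "inj_on (map_prod g g) (verts G \<times> verts G)"
        using bij by (simp add: bij_betw_def map_prod_inj_on)
      show "arcs_ends G \<subseteq> verts G \<times> verts G"
        by (auto dest: G.adj_in_verts)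
    qed
    show "e \<in> arcs_ends H" if "e \<in> map_prod g g ` arcs_ends G" for e
      using that adj by (auto dest: G.adj_in_verts)
    show "e \<in> map_prod g g ` arcs_ends G" if e: "e \<in> arcs_ends H" for e
    proof -
      obtain x y where "e = (x, y)"
        by (cases e)
      with e have "x \<in> g ` verts G" "y \<in> g ` verts G"
        using bij by (auto simp: bij_betw_def dest: H.adj_in_verts)
      then obtain u v where uv: "e = (g u, g v)" "u \<in> verts G" "v \<in> verts G"
        using \<open>e = (x, y)\<close> by blast
      then have "(u, v) \<in> arcs_ends G"
        using e adj by blast
      then show ?thesis
        using uv by force
    qed
  qed
  have arcs_G: "bij_betw (arc_to_ends G) (arcs G) (arcs_ends G)"
    and arcs_H: "bij_betw (arc_to_ends H) (arcs H) (arcs_ends H)"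
    using G.inj_on_arc_to_ends H.inj_on_arc_to_ends by (auto simp: bij_betw_def arcs_ends_def)
  let ?h = "the_inv_into (arcs H) (arc_to_ends H) \<circ> (map_prod g g \<circ> arc_to_ends G)"
  have h: "bij_betw ?h (arcs G) (arcs H)"
    by (intro bij_betw_trans[OF bij_betw_trans[OF arcs_G ends]] bij_betw_the_inv_into arcs_H)
  have "arc_to_ends H (?h a) = map_prod g g (arc_to_ends G a)" if "a \<in> arcs G" for a
  proof -
    have "map_prod g g (arc_to_ends G a) \<in> arcs_ends H"
      using that bij_betw_apply[OF ends] by (simp add: arcs_ends_def)
    then have "map_prod g g (arc_to_ends G a) \<in> arc_to_ends H ` arcs H"
      by (simp add: arcs_ends_def)
    then show ?thesis
      using arcs_H by (simp add: bij_betw_def f_the_inv_into_f)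
  qed
  then have h_ends: "tail H (?h a) = g (tail G a) \<and> head H (?h a) = g (head G a)" if "a \<in> arcs G" for a
    using that by (simp add: arc_to_ends_def)
  let ?iso = "\<lparr>iso_verts = g, iso_arcs = ?h, iso_head = head H, iso_tail = tail H\<rparr>"
  have "G.digraph_isomorphism ?iso"
    unfolding G.digraph_isomorphism_def using G.wf_digraph bij h h_ends
    by (auto simp: bij_betw_def)
  moreover have "H = app_iso ?iso G"
    using bij h by (simp add: app_iso_def bij_betw_def)
  ultimately show ?thesis
    unfolding digraph_iso_def by blast
qed

section \<open>What the domination polynomial determines\<close>

context graph
begin

interpretation nbhds: closed_nbhds "verts G" "closed_nbhd G"
  by (rule closed_nbhds_graph)

lemma dominating_set_iff:
  "dominating_set G S \<longleftrightarrow> S \<subseteq> verts G \<and> \<not> (\<exists>v\<in>verts G. closed_nbhd G v \<subseteq> verts G - S)"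
proof (cases "S \<subseteq> verts G")
  case True
  have "(\<Union>v\<in>S. closed_nbhd G v) = verts G \<longleftrightarrow> (\<forall>v\<in>verts G. \<exists>s\<in>S. v \<in> closed_nbhd G s)"
    using True nbhds.N_subset by blast
  also have "\<dots> \<longleftrightarrow> (\<forall>v\<in>verts G. \<exists>s\<in>S. s \<in> closed_nbhd G v)"
    using True nbhds.N_sym by (meson subsetD)
  also have "\<dots> \<longleftrightarrow> \<not> (\<exists>v\<in>verts G. closed_nbhd G v \<subseteq> verts G - S)"
    using nbhds.N_subset by blast
  finally show ?thesis
    using True by (simp add: dominating_set_def)
qed (simp add: dominating_set_def)

text \<open>
  Complementation matches the non-dominating \<open>i\<close>-sets with the sets of the complementary size that
  contain a closed neighbourhood.
\<close>

lemma num_dominating_sets_plus_enclosing: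
  assumes "i \<le> card (verts G)"
  shows "num_dominating_sets G i + card (nbhds.enclosing (card (verts G) - i)) = card (verts G) choose i"
proof -
  let ?V = "verts G"
  let ?D = "{S. dominating_set G S \<and> card S = i}"
  let ?F = "{S. S \<subseteq> ?V \<and> card S = i \<and> \<not> dominating_set G S}"
  have compl: "card (?V - S) = card ?V - card S" if "S \<subseteq> ?V" for S
    by (rule card_Diff_subset[OF finite_subset[OF that finite_verts] that])
  have "bij_betw (\<lambda>S. ?V - S) ?F (nbhds.enclosing (card ?V - i))"
  proof (rule bij_betw_byWitness[where f' = "\<lambda>T. ?V - T"])
    show "(\<lambda>S. ?V - S) ` ?F \<subseteq> nbhds.enclosing (card ?V - i)"
      by (auto simp: dominating_set_iff nbhds.enclosing_def supersets_def compl)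
    show "(\<lambda>T. ?V - T) ` nbhds.enclosing (card ?V - i) \<subseteq> ?F"
      using assms by (auto simp: dominating_set_iff nbhds.enclosing_def supersets_def compl double_diff)
  qed (auto simp: nbhds.enclosing_def supersets_def)
  then have "card ?F = card (nbhds.enclosing (card ?V - i))"
    by (rule bij_betw_same_card)
  moreover have "card (?D \<union> ?F) = card ?D + card ?F"
    by (rule card_Un_disjoint) (auto intro: finite_subset[of _ "Pow ?V"] simp: dominating_set_def)
  moreover have "?D \<union> ?F = {S. S \<subseteq> ?V \<and> card S = i}"
    by (auto simp: dominating_set_def)
  ultimately show ?thesis
    using n_subsets[of ?V i] by (simp add: num_dominating_sets_def)
qed

lemma num_dominating_sets_verts: "num_dominating_sets G (card (verts G)) \<noteq> 0"
proof -
  have "dominating_set G (verts G)"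
    using nbhds.self_in by (auto simp: dominating_set_iff)
  then have "verts G \<in> {S. dominating_set G S \<and> card S = card (verts G)}"
    by simp
  moreover have "finite {S. dominating_set G S \<and> card S = card (verts G)}"
    by (rule finite_subset[of _ "Pow (verts G)"]) (auto simp: dominating_set_def)
  ultimately show ?thesis
    unfolding num_dominating_sets_def by (metis card_0_eq empty_iff)
qed

lemma num_dominating_sets_range:
  assumes "num_dominating_sets G i \<noteq> 0"
  shows "domination_number G \<le> i" "i \<le> card (verts G)"
proof -
  obtain S where S: "dominating_set G S" "card S = i"
    using assms unfolding num_dominating_sets_def by (metis (mono_tags, lifting) card.empty empty_Collect_eq)
  have "finite {S. dominating_set G S}"
    by (rule finite_subset[of _ "Pow (verts G)"]) (auto simp: dominating_set_def)
  then show "domination_number G \<le> i"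
    unfolding domination_number_def using S by (intro Min_le) auto
  show "i \<le> card (verts G)"
    using S card_mono[OF finite_verts] by (auto simp: dominating_set_def)
qed

text \<open>
  The polynomial sums only from the domination number to the number of vertices, but outside this
  range there are no dominating sets to be counted.
\<close>

lemma coeff_domination_poly: "coeff (domination_poly G) i = int (num_dominating_sets G i)"
proof -
  have "coeff (domination_poly G) i =
      (\<Sum>j = domination_number G..card (verts G). if j = i then int (num_dominating_sets G j) else 0)"
    by (simp add: domination_poly_def coeff_sum)
  also have "\<dots> = int (num_dominating_sets G i)"
    using num_dominating_sets_range[of i] by (auto simp: sum.delta)
  finally show ?thesis .
qed

end

text \<open>
  The number of vertices is the degree of the domination polynomial, since the set of all vertices is
  dominating.
\<close>

lemma domination_poly_eqD:
  assumes G: "graph G" and H: "graph H" and eq: "domination_poly G = domination_poly H"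
  shows "card (verts G) = card (verts H)"
    and "k \<le> card (verts G) \<Longrightarrow>
      card (closed_nbhds.enclosing (verts G) (closed_nbhd G) k) =
      card (closed_nbhds.enclosing (verts H) (closed_nbhd H) k)"
proof -
  interpret G: graph G by fact
  interpret H: graph H by fact
  have num: "num_dominating_sets G i = num_dominating_sets H i" for i
    using eq G.coeff_domination_poly[of i] H.coeff_domination_poly[of i] by simp
  show card: "card (verts G) = card (verts H)"
    using G.num_dominating_sets_verts H.num_dominating_sets_verts
      G.num_dominating_sets_range(2) H.num_dominating_sets_range(2)
    by (metis num order_antisym)
  show "card (closed_nbhds.enclosing (verts G) (closed_nbhd G) k) =
      card (closed_nbhds.enclosing (verts H) (closed_nbhd H) k)" if "k \<le> card (verts G)"
    using G.num_dominating_sets_plus_enclosing[of "card (verts G) - k"]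
      H.num_dominating_sets_plus_enclosing[of "card (verts G) - k"] that num card by simp
qed

theorem theorem5:
  fixes G :: "('a, 'b) pre_digraph"
  assumes "graph G"
    and "domination_poly G = domination_poly petersen"
  shows "digraph_iso G petersen"
proof -
  interpret G: graph G by fact
  interpret nbhds: closed_nbhds "verts G" "closed_nbhd G"
    by (rule G.closed_nbhds_graph)
  have card: "card (verts G) = 10"
    using domination_poly_eqD(1)[OF assms(1) graph_petersen assms(2)] by (simp add: verts_petersen)
  have "card (nbhds.enclosing k) = card (petersen.enclosing k)" if "k \<le> 10" for k
    using domination_poly_eqD(2)[OF assms(1) graph_petersen assms(2), of k] that card
    by (simp add: verts_petersen)
  then have "nbhds.cubic_girth_5"
    using cubic_girth_5_petersen card
    by (simp add: nbhds.cubic_girth_5_iff_card_enclosing petersen.cubic_girth_5_iff_card_enclosing)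
  then obtain f where f: "bij_betw f {0..<10} (verts G)"
      and nbhd: "\<And>i. i \<in> {0..<10} \<Longrightarrow> f ` closed_nbhd petersen i = closed_nbhd G (f i)"
    using nbhds.petersen_labelling[OF _ card] by blast
  let ?g = "the_inv_into {0..<10} f"
  show ?thesis
  proof (rule digraph_iso_if_bij_preserves_closed_nbhd[OF assms(1) graph_petersen])
    show "bij_betw ?g (verts G) (verts petersen)"
      using f by (simp add: verts_petersen bij_betw_the_inv_into)
    fix v assume "v \<in> verts G"
    then have "v \<in> f ` {0..<10}"
      using f by (simp add: bij_betw_def)
    then obtain i where i: "i \<in> {0..<10}" "v = f i"
      by blast
    have inj: "inj_on f {0..<10}"
      using f by (simp add: bij_betw_def)
    have "?g ` f ` closed_nbhd petersen i = (\<lambda>j. j) ` closed_nbhd petersen i"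
      unfolding image_image
      by (rule image_cong[OF refl])
        (use petersen.N_subset[OF i(1)] in \<open>auto intro!: the_inv_into_f_f[OF inj]\<close>)
    then show "?g ` closed_nbhd G v = closed_nbhd petersen (?g v)"
      using i by (simp add: nbhd the_inv_into_f_f[OF inj])
  qed
qed

end
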